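(* Assume the 3x+1 conjecture holds (every positive integer reaches $1$ under iteration of the Collatz function $C$). Let $N$ be a positive integer with $O(N)\ge 20$. Then $$\mathrm{Res}(N)<O(N)^{1/9}.$$
   Context: The Collatz function on positive integers is $C(N)=3N+1$ if $N$ is odd and $C(N)=N/2$ if $N$ is even. For a positive integer $N$ whose iterates under $C$ reach $1$, iterate $C$ from $N$ until $1$ is reached for the first time (zero steps if $N=1$). $O(N)$ is the number of odd steps (steps applying $C$ to an odd integer) and $E(N)$ is the number of even steps (steps applying $C$ to an even integer). The Residue of $N$ is $\mathrm{Res}(N)=\dfrac{2^{E(N)}}{3^{O(N)}\cdot N}$. *)

theory Defs
  imports Complex_Main
begin

definition collatz :: "nat \<Rightarrow> nat" where
  "collatz n = (if odd n then 3 * n + 1 else n div 2)"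

definition collatz_conjecture :: bool where
  "collatz_conjecture \<longleftrightarrow> (\<forall>n>0. \<exists>k. (collatz ^^ k) n = 1)"

(* Only meaningful if the iterates of n reach 1; otherwise LEAST is unspecified. *)
definition total_steps :: "nat \<Rightarrow> nat" where
  "total_steps n = (LEAST k. (collatz ^^ k) n = 1)"

definition odd_steps :: "nat \<Rightarrow> nat" where
  "odd_steps n = card {i. i < total_steps n \<and> odd ((collatz ^^ i) n)}"

definition even_steps :: "nat \<Rightarrow> nat" where
  "even_steps n = card {i. i < total_steps n \<and> even ((collatz ^^ i) n)}"

definition Res :: "nat \<Rightarrow> real" where
  "Res n = 2 ^ even_steps n / (3 ^ odd_steps n * real n)"

end

theory Submission
  imports Defs
begin

text \<open>
  Writing \<open>s\<close> for the odd iterates before \<open>1\<close>, one has \<open>Res N = (\<Prod>s. 1 + 1 / (3 s))\<close>. The iterates before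
  the first \<open>1\<close> are distinct, and since \<open>3 n + 1\<close> is never divisible by 3, at most one \<open>s\<close> is a
  multiple of 3. As the trajectories of 3, 9, 15 and 21 contain fewer than 20 odd numbers, that
  exceptional \<open>s\<close> is at least 27. Hence \<open>Res N\<close> is at most \<open>1 + 1/81\<close> times the product over the first
  \<open>odd_steps N - 1\<close> numbers \<open>5, 7, 11, 13, \<dots>\<close> coprime to 6. By \<open>(1 + 1/a)^9 \<le> (a + 5) / (a - 4)\<close>, the ninth
  power of this bound grows more slowly than \<open>odd_steps N\<close>, and at 20 and 21 it is already smaller.
\<close>

section \<open>The product formula and distinctness of iterates\<close>

lemma collatz_pos: "n > 0 \<Longrightarrow> collatz n > 0"
  by (auto simp: collatz_def elim!: evenE)

lemma collatz_iterate_pos: "n > 0 \<Longrightarrow> (collatz ^^ k) n > 0"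
  by (induction k) (auto intro: collatz_pos)

text \<open>Induction on \<open>k\<close>: an even step halves the iterate \<open>x\<close>, an odd
  step multiplies it by \<open>3 * (1 + 1 / (3 * x))\<close>. Once the iterate is 1, only a power of
  2 remains on the left.\<close>

lemma collatz_iterate_product:
  fixes n :: nat
  assumes "n > 0"
  shows "2 ^ card {i. i < k \<and> even ((collatz ^^ i) n)} * real ((collatz ^^ k) n) =
    3 ^ card {i. i < k \<and> odd ((collatz ^^ i) n)} * real n *
      (\<Prod>i | i < k \<and> odd ((collatz ^^ i) n). 1 + 1 / (3 * real ((collatz ^^ i) n)))"
proof (induction k)
  case 0
  then show ?case by simp
next
  case (Suc k)
  let ?x = "(collatz ^^ k) n"
  have x: "?x > 0" using assms by (rule collatz_iterate_pos)
  have less_Suc: "{i. i < Suc k \<and> P i} = (if P k then insert k {i. i < k \<and> P i} else {i. i < k \<and> P i})"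
    for P by (auto simp: less_Suc_eq)
  show ?case
  proof (cases "even ?x")
    case True
    then have "real ?x = 2 * real (collatz ?x)" by (auto simp: collatz_def elim!: evenE)
    with Suc True show ?thesis by (simp add: less_Suc)
  next
    case False
    then have "real (collatz ?x) = real ?x * 3 * (1 + 1 / (3 * real ?x))"
      using x by (simp add: collatz_def field_simps)
    with Suc False show ?thesis by (simp add: less_Suc mult.assoc[symmetric])
  qed
qed

text \<open>If a value occurred twice, skipping the steps between its occurrences would reach 1 in
  fewer than \<open>total_steps n\<close> steps.\<close>

lemma collatz_iterate_inj_on:
  assumes "\<exists>k. (collatz ^^ k) n = 1"
  shows "inj_on (\<lambda>i. (collatz ^^ i) n) {i. i < total_steps n}"
proof (rule linorder_inj_onI')
  fix i j assume "j \<in> {i. i < total_steps n}" "i < j"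
  then have ij: "i < j" "j < total_steps n" by auto
  let ?T = "total_steps n"
  have T: "(collatz ^^ ?T) n = 1"
    unfolding total_steps_def using assms by (rule LeastI_ex)
  show "(collatz ^^ i) n \<noteq> (collatz ^^ j) n"
  proof
    assume eq: "(collatz ^^ i) n = (collatz ^^ j) n"
    have "(collatz ^^ (?T - j + i)) n = (collatz ^^ (?T - j)) ((collatz ^^ i) n)"
      by (simp add: funpow_add)
    also have "\<dots> = (collatz ^^ (?T - j + j)) n"
      unfolding eq by (simp only: funpow_add o_apply)
    finally have "(collatz ^^ (?T - j + i)) n = 1" using T ij by simp
    then have "?T \<le> ?T - j + i" unfolding total_steps_def by (rule Least_le)
    with ij show False by simp
  qed
qed

section \<open>Multiples of 3 along a trajectory\<close>

lemma not_3_dvd_collatz: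
  assumes "odd n \<or> \<not> 3 dvd n"
  shows "\<not> 3 dvd collatz n"
  using assms unfolding collatz_def by presburger

text \<open>Halving cannot create a factor 3 either, so among the odd iterates only the first can be
  a multiple of 3.\<close>

lemma not_3_dvd_collatz_iterate:
  assumes "odd ((collatz ^^ i) n)" "i < j"
  shows "\<not> 3 dvd (collatz ^^ j) n"
  using assms(2)
proof (induction j)
  case (Suc j)
  then show ?case
    using assms(1) not_3_dvd_collatz by (cases "i = j") auto
qed simp

text \<open>The union of the trajectories of 3, 9, 15 and 21.\<close>

definition small_orbits :: "nat set" where
  "small_orbits = {1, 2, 3, 4, 5, 7, 8, 9, 10, 11, 13, 14, 15, 16, 17, 20, 21, 22, 23, 26, 28, 32,
    34, 35, 40, 46, 52, 53, 64, 70, 80, 106, 160}"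

lemma collatz_small_orbits: "n \<in> small_orbits \<Longrightarrow> collatz n \<in> small_orbits"
  unfolding small_orbits_def by (auto simp: collatz_def)

lemma collatz_iterate_small_orbits:
  assumes "(collatz ^^ i) n \<in> small_orbits" "i \<le> j"
  shows "(collatz ^^ j) n \<in> small_orbits"
  using assms(2) by (induction j rule: dec_induct) (auto simp: assms(1) collatz_small_orbits)

lemma card_odd_small_orbits: "card {n \<in> small_orbits. odd n} < 20"
proof -
  have "{n \<in> small_orbits. odd n} = {1, 3, 5, 7, 9, 11, 13, 15, 17, 21, 23, 35, 53}"
    unfolding small_orbits_def by auto
  then show ?thesis by simp
qed

lemma odd_multiple_of_3_ge_27:
  fixes s :: nat
  assumes "s \<noteq> 3" "s \<noteq> 9" "s \<noteq> 15" "s \<noteq> 21" "odd s" "3 dvd s"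
  shows "s \<ge> 27"
  using assms by presburger

section \<open>Comparison with the numbers coprime to 6\<close>

text \<open>The \<open>k\<close>-th smallest element of a set of positive integers is at least
  \<open>k\<close>. The induction adds elements in increasing order, so each new maximum is at least
  the new cardinality.\<close>

lemma prod_antimono_le_prod_atLeastAtMost:
  fixes h :: "nat \<Rightarrow> real"
  assumes "finite B" "0 \<notin> B"
    and nonneg: "\<And>k. h k \<ge> 0"
    and antimono: "\<And>i j. i \<le> j \<Longrightarrow> h j \<le> h i"
  shows "prod h B \<le> prod h {1..card B}"
  using assms(1,2)
proof (induction B rule: finite_linorder_max_induct)
  case (insert b A)
  have "insert b A \<subseteq> {1..b}"
  proof
    fix x assume x: "x \<in> insert b A"
    then have "x \<noteq> 0" using insert.prems by metis
    moreover have "x \<le> b" using x insert.hyps by (auto intro: less_imp_le)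
    ultimately show "x \<in> {1..b}" by simp
  qed
  then have "card (insert b A) \<le> b" using card_mono[of "{1..b}"] by fastforce
  moreover have "b \<notin> A" using insert.hyps by blast
  ultimately have "h b \<le> h (Suc (card A))" using insert.hyps by (intro antimono) simp
  then have "h b * prod h A \<le> h (Suc (card A)) * prod h {1..card A}"
    using insert by (intro mult_mono prod_nonneg nonneg) auto
  with \<open>b \<notin> A\<close> insert.hyps show ?case by (simp add: mult.commute)
qed simp

text \<open>The \<open>k\<close>-th of the numbers \<open>5, 7, 11, 13, \<dots>\<close> coprime to 6, for \<open>k \<ge> 1\<close>.\<close>

definition coprime6 :: "nat \<Rightarrow> nat" where
  "coprime6 k = 3 * k + 1 + k mod 2"

lemma coprime6_mono: "i \<le> j \<Longrightarrow> coprime6 i \<le> coprime6 j"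
  by (cases "i = j") (auto simp: coprime6_def mod_2_eq_odd)

text \<open>The numbers \<open>6 * q + 1\<close> and \<open>6 * q + 5\<close> have the indices
  \<open>2 * q\<close> and \<open>2 * q + 1\<close>, so division by 3 recovers the index. Index 0
  belongs to the number 1.\<close>

lemma coprime6_div_3:
  assumes "odd a" "\<not> 3 dvd a"
  shows "coprime6 (a div 3) = a"
proof -
  have "a mod 6 = 1 \<or> a mod 6 = 5" using assms by presburger
  then obtain q where "a = 6 * q + 1 \<or> a = 6 * q + 5"
    by (metis mult_div_mod_eq)
  then show ?thesis
  proof
    assume a: "a = 6 * q + 1"
    then have "a div 3 = 2 * q" by simp
    with a show ?thesis by (simp add: coprime6_def)
  next
    assume a: "a = 6 * q + 5"
    then have "a div 3 = 2 * q + 1" by simp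
    with a show ?thesis by (simp add: coprime6_def)
  qed
qed

definition factor :: "nat \<Rightarrow> real" where
  "factor k = 1 + 1 / (3 * real (coprime6 k))"

lemma factor_nonneg: "factor k \<ge> 0"
  by (simp add: factor_def)

lemma factor_antimono: "i \<le> j \<Longrightarrow> factor j \<le> factor i"
  using coprime6_mono[of i j] unfolding factor_def
  by (intro add_left_mono divide_left_mono) (simp_all add: coprime6_def)

text \<open>The indices \<open>a div 3\<close> are distinct and positive, since an odd
  \<open>a\<close> of index 0 is 1. The antimonotone comparison then applies to the index
  set.\<close>

lemma prod_coprime6_le:
  assumes "finite A" and A: "\<And>a. a \<in> A \<Longrightarrow> odd a \<and> \<not> 3 dvd a \<and> a \<noteq> 1"
  shows "(\<Prod>a\<in>A. 1 + 1 / (3 * real a)) \<le> prod factor {1..card A}"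
proof -
  have inj: "inj_on (\<lambda>a. a div 3) A"
    by (rule inj_on_inverseI[where g = coprime6]) (use A coprime6_div_3 in blast)
  have "0 \<notin> (\<lambda>a. a div 3) ` A"
  proof
    assume "0 \<in> (\<lambda>a. a div 3) ` A"
    then obtain a where "a \<in> A" "a div 3 = 0" by (elim imageE) simp
    moreover from this have "a = 0 \<or> a = 1 \<or> a = 2" by (auto simp: div_eq_0_iff)
    ultimately show False using A[of a] by auto
  qed
  with \<open>finite A\<close> have "prod factor ((\<lambda>a. a div 3) ` A) \<le> prod factor {1..card ((\<lambda>a. a div 3) ` A)}"
    by (intro prod_antimono_le_prod_atLeastAtMost factor_nonneg factor_antimono) auto
  moreover have "prod factor ((\<lambda>a. a div 3) ` A) = (\<Prod>a\<in>A. 1 + 1 / (3 * real a))"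
    unfolding prod.reindex[OF inj] using A coprime6_div_3
    by (intro prod.cong) (simp_all add: factor_def)
  ultimately show ?thesis by (simp add: card_image[OF inj])
qed

section \<open>Growth of the ninth power\<close>

lemma power9_one_plus_inverse_le:
  fixes a :: real
  assumes "a > 4"
  shows "(1 + 1 / a) ^ 9 \<le> (a + 5) / (a - 4)"
proof -
  \<comment> \<open>The right-hand side is the telescoping product of \<open>(a + j + 1) / (a + j)\<close> over \<open>-4 \<le> j \<le> 4\<close>; the
    factors for \<open>j\<close> and \<open>-j\<close> together are at least \<open>((a + 1) / a)\<^sup>2\<close>.\<close>
  have pair: "(1 + 1 / a) ^ 2 \<le> ((a + 1 + j) / (a + j)) * ((a + 1 - j) / (a - j))"
    if "0 \<le> j" "j \<le> 4" for j
  proof -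
    \<comment> \<open>After cancelling \<open>a\<^sup>2 * (a + 1)\<^sup>2\<close> this is
      \<open>a\<^sup>2 * j\<^sup>2 \<le> (a + 1)\<^sup>2 * j\<^sup>2\<close>.\<close>
    have "(a\<^sup>2 - j\<^sup>2) * (a + 1)\<^sup>2 \<le> ((a + 1)\<^sup>2 - j\<^sup>2) * a\<^sup>2"
      using assms mult_right_mono[of "a\<^sup>2" "(a + 1)\<^sup>2" "j\<^sup>2"] by (simp add: algebra_simps power_mono)
    moreover have "a\<^sup>2 - j\<^sup>2 > 0" using assms that by (simp add: power_strict_mono)
    ultimately have "((a + 1) / a)\<^sup>2 \<le> ((a + 1)\<^sup>2 - j\<^sup>2) / (a\<^sup>2 - j\<^sup>2)"
      using assms by (simp add: power_divide divide_simps mult_ac)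
    moreover have "1 + 1 / a = (a + 1) / a" using assms by (simp add: field_simps)
    moreover have "(a + 1)\<^sup>2 - j\<^sup>2 = (a + 1 + j) * (a + 1 - j)" "a\<^sup>2 - j\<^sup>2 = (a + j) * (a - j)"
      by (simp_all add: power2_eq_square algebra_simps)
    ultimately show ?thesis by simp
  qed
  let ?g = "\<lambda>j. ((a + 1 + j) / (a + j)) * ((a + 1 - j) / (a - j))"
  have "(1 + 1 / a) ^ 9 = (1 + 1 / a) * ((1 + 1 / a)\<^sup>2 * ((1 + 1 / a)\<^sup>2 * ((1 + 1 / a)\<^sup>2 * (1 + 1 / a)\<^sup>2)))"
    by (simp add: eval_nat_numeral)
  also have "\<dots> \<le> (1 + 1 / a) * (?g 1 * (?g 2 * (?g 3 * ?g 4)))"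
    using assms by (intro mult_mono pair) auto
  also have "\<dots> = (a + 5) / (a - 4)"
    using assms by (simp add: divide_simps) (simp add: ac_simps)
  finally show ?thesis .
qed

text \<open>Two consecutive factors are bounded together: for even \<open>n\<close> the bound
  \<open>(9 * n + 8) / (9 * n - 1)\<close> obtained for \<open>factor n\<close> alone exceeds
  \<open>(n + 1) / n\<close>.\<close>

lemma factor_pair_power9:
  assumes "n \<ge> 3"
  shows "(factor n * factor (Suc n)) ^ 9 \<le> (real n + 2) / real n"
proof (cases "even n")
  case True
  then have "factor n = 1 + 1 / (9 * real n + 3)" "factor (Suc n) = 1 + 1 / (9 * real n + 15)"
    by (auto simp: factor_def coprime6_def mod_2_eq_odd algebra_simps)
  then have "(factor n * factor (Suc n)) ^ 9 \<le>
      ((9 * real n + 3 + 5) / (9 * real n + 3 - 4)) * ((9 * real n + 15 + 5) / (9 * real n + 15 - 4))"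
    unfolding power_mult_distrib
    using assms power9_one_plus_inverse_le[of "9 * real n + 3"] power9_one_plus_inverse_le[of "9 * real n + 15"]
    by (intro mult_mono) simp_all
  \<comment> \<open>With denominators cleared, the right side minus the left is
    \<open>9 * n - 22\<close>, positive by \<open>n \<ge> 3\<close>.\<close>
  also have "\<dots> \<le> (real n + 2) / real n"
    using assms by (simp add: divide_simps) (simp add: algebra_simps)
  finally show ?thesis .
next
  case False
  then have "factor n = 1 + 1 / (9 * real n + 6)" "factor (Suc n) = 1 + 1 / (9 * real n + 12)"
    by (auto simp: factor_def coprime6_def mod_2_eq_odd algebra_simps)
  then have "(factor n * factor (Suc n)) ^ 9 \<le>
      ((9 * real n + 6 + 5) / (9 * real n + 6 - 4)) * ((9 * real n + 12 + 5) / (9 * real n + 12 - 4))"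
    unfolding power_mult_distrib
    using assms power9_one_plus_inverse_le[of "9 * real n + 6"] power9_one_plus_inverse_le[of "9 * real n + 12"]
    by (intro mult_mono) simp_all
  also have "\<dots> \<le> (real n + 2) / real n"
    using assms by (simp add: divide_simps) (simp add: algebra_simps)
  finally show ?thesis .
qed

text \<open>The bound 1.393 lies just below the ninth root of 20 and is a short fraction whose ninth
  power is easy to evaluate.\<close>

lemma prod_factor_19: "82 / 81 * prod factor {1..19} < 1393 / 1000"
proof -
  have "{1..19::nat} = set [1..<20]" by auto
  also have "[1..<20] = [1, 2, 3, 4, 5, 6, 7, 8, 9, 10, 11, 12, 13, 14, 15, 16, 17, 18, 19::nat]"
    by (simp add: upt_rec)
  finally show ?thesis by (simp add: factor_def coprime6_def)
qed

text \<open>Induction in steps of two, hence two base cases: a pair of factors costs at most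
  \<open>(m + 2) / m\<close>, which turns the bound \<open>m\<close> into
  \<open>m + 2\<close>.\<close>

lemma prod_factor_power9:
  assumes "n \<ge> 20"
  shows "(82 / 81 * prod factor {1..n - 1}) ^ 9 < real n"
  using assms
proof (induction n rule: less_induct)
  case (less n)
  have nonneg: "prod factor A \<ge> 0" for A by (intro prod_nonneg factor_nonneg)
  consider "n = 20" | "n = 21" | "n \<ge> 22" using less.prems by linarith
  then show ?case
  proof cases
    case 1
    have "(82 / 81 * prod factor {1..19}) ^ 9 < (1393 / 1000) ^ 9"
      using prod_factor_19 by (intro power_strict_mono) (auto intro: nonneg)
    also have "\<dots> < (20::real)" by (simp add: power_divide)
    finally show ?thesis using 1 by simp
  next
    case 2
    have "{1..20::nat} = insert 20 {1..19}" by auto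
    \<comment> \<open>Here \<open>coprime6 20 = 61\<close>, so
      \<open>factor 20 = 1 + 1 / 183\<close>.\<close>
    then have "82 / 81 * prod factor {1..20} = (82 / 81 * prod factor {1..19}) * (184 / 183)"
      by (simp add: factor_def coprime6_def)
    also have "\<dots> < 1393 / 1000 * (184 / 183)" using prod_factor_19 by simp
    finally have "(82 / 81 * prod factor {1..20}) ^ 9 < (1393 / 1000 * (184 / 183)) ^ 9"
      by (intro power_strict_mono) (auto intro: nonneg)
    also have "\<dots> < (21::real)" by (simp add: power_divide)
    finally show ?thesis using 2 by simp
  next
    case 3
    define m where "m = n - 2"
    with 3 have m: "n = m + 2" "m \<ge> 20" by simp_all
    have "{1..n - 1} = insert (Suc m) (insert m {1..m - 1})" using m by auto
    moreover have "m \<notin> {1..m - 1}" using m by auto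
    moreover have "Suc m \<notin> insert m {1..m - 1}" by auto
    ultimately have "82 / 81 * prod factor {1..n - 1} =
        82 / 81 * prod factor {1..m - 1} * (factor m * factor (Suc m))"
      by simp
    then have "(82 / 81 * prod factor {1..n - 1}) ^ 9 =
        (82 / 81 * prod factor {1..m - 1}) ^ 9 * (factor m * factor (Suc m)) ^ 9"
      by (simp only: power_mult_distrib)
    also have "\<dots> \<le> (82 / 81 * prod factor {1..m - 1}) ^ 9 * ((real m + 2) / real m)"
      using m by (intro mult_left_mono factor_pair_power9 zero_le_power) (auto intro: nonneg)
    also have "\<dots> < real m * ((real m + 2) / real m)"
      using m less.IH[of m] by (intro mult_strict_right_mono) auto
    also have "\<dots> = real n" using m by simp
    finally show ?thesis .
  qed
qed

theorem theorem3p5: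
  fixes N :: nat
  assumes "collatz_conjecture"
    and "N > 0"
    and "odd_steps N \<ge> 20"
  shows "Res N < real (odd_steps N) powr (1 / 9)"
proof -
  let ?c = "\<lambda>i. (collatz ^^ i) N"
  define T where "T = total_steps N"
  define I where "I = {i. i < T \<and> odd (?c i)}"
  define S where "S = ?c ` I"
  define n where "n = odd_steps N"
  let ?f = "\<lambda>s. 1 + 1 / (3 * real s)"
  have ex: "\<exists>k. ?c k = 1" using assms by (auto simp: collatz_conjecture_def)
  then have T: "?c T = 1" unfolding T_def total_steps_def by (rule LeastI_ex)
  have inj: "inj_on ?c I"
    using collatz_iterate_inj_on[OF ex] by (rule inj_on_subset) (auto simp: I_def T_def)
  have n: "n = card I" "n = card S"
    using card_image[OF inj] by (auto simp: n_def odd_steps_def I_def T_def S_def)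
  have n20: "n \<ge> 20" using assms n_def by simp
  have "finite I" by (simp add: I_def)
  then have finS: "finite S" by (simp add: S_def)
  have "2 ^ even_steps N = 3 ^ n * real N * prod (\<lambda>i. ?f (?c i)) I"
    using collatz_iterate_product[OF assms(2), of T] T
    by (simp add: n I_def even_steps_def T_def)
  then have Res: "Res N = prod ?f S"
    using assms(2) by (simp add: Res_def n_def S_def prod.reindex[OF inj])
  have odd: "odd s" if "s \<in> S" for s using that by (auto simp: S_def I_def)
  have ne1: "s \<noteq> 1" if "s \<in> S" for s
    using that not_less_Least by (fastforce simp: S_def I_def T_def total_steps_def)
  have "prod ?f S \<le> 82 / 81 * prod factor {1..n - 1}"
  proof (cases "\<exists>s\<in>S. 3 dvd s")
    case True
    then obtain i where i: "i \<in> I" "3 dvd ?c i" by (auto simp: S_def)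
    \<comment> \<open>An odd iterate before position \<open>i\<close> would prevent 3 from dividing
      the iterate at \<open>i\<close>.\<close>
    have first: "i \<le> j" if "j \<in> I" for j
      using that i not_3_dvd_collatz_iterate by (force simp: I_def not_less[symmetric])
    have notdvd: "\<not> 3 dvd ?c j" if "j \<in> I" "j \<noteq> i" for j
      using first[OF that(1)] that i not_3_dvd_collatz_iterate[of i N j] by (auto simp: I_def)
    have "?c i \<notin> small_orbits"
    proof
      assume "?c i \<in> small_orbits"
      \<comment> \<open>Every odd iterate occurs at position \<open>i\<close> or later, and
        \<open>small_orbits\<close> is closed under \<open>collatz\<close>.\<close>
      then have "S \<subseteq> {n \<in> small_orbits. odd n}"
        using first collatz_iterate_small_orbits by (auto simp: S_def I_def)
      then have "card S \<le> card {n \<in> small_orbits. odd n}"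
        by (intro card_mono) (simp_all add: small_orbits_def)
      with card_odd_small_orbits n n20 show False by simp
    qed
    then have "?c i \<noteq> 3" "?c i \<noteq> 9" "?c i \<noteq> 15" "?c i \<noteq> 21"
      by (auto simp: small_orbits_def)
    moreover have "odd (?c i)" using i by (simp add: I_def)
    ultimately have ge27: "?c i \<ge> 27" using i(2) by (rule odd_multiple_of_3_ge_27)
    have ci: "?c i \<in> S" using i by (simp add: S_def)
    then have "prod ?f S = ?f (?c i) * prod ?f (S - {?c i})"
      using finS by (rule prod.remove[rotated])
    also have "\<dots> \<le> 82 / 81 * prod factor {1..card (S - {?c i})}"
    proof (intro mult_mono prod_coprime6_le)
      \<comment> \<open>The value is \<open>1 + 1 / (3 * 27)\<close>, attained at 27.\<close>
      show "?f (?c i) \<le> 82 / 81" using ge27 by (simp add: field_simps)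
      show "odd a \<and> \<not> 3 dvd a \<and> a \<noteq> 1" if "a \<in> S - {?c i}" for a
        using that odd ne1 notdvd by (auto simp: S_def)
    qed (use finS in \<open>auto intro!: prod_nonneg\<close>)
    finally show ?thesis using ci n by simp
  next
    case False
    then have "prod ?f S \<le> prod factor {1..n}"
      unfolding n(2) using finS odd ne1 by (intro prod_coprime6_le) auto
    also have "{1..n} = insert n {1..n - 1}" using n20 by auto
    also have "prod factor \<dots> = factor n * prod factor {1..n - 1}"
      using n20 by (subst prod.insert) auto
    \<comment> \<open>For \<open>n \<ge> 20\<close>, \<open>coprime6 n\<close> exceeds 27, so the
      last factor is below 82/81 and both cases share one bound.\<close>
    also have "\<dots> \<le> 82 / 81 * prod factor {1..n - 1}"
      using n20 by (intro mult_right_mono prod_nonneg factor_nonneg)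
        (auto simp: factor_def coprime6_def field_simps)
    finally show ?thesis .
  qed
  moreover have "prod ?f S \<ge> 0" by (intro prod_nonneg) simp
  ultimately have "Res N ^ 9 \<le> (82 / 81 * prod factor {1..n - 1}) ^ 9" "Res N \<ge> 0"
    unfolding Res by (auto intro: power_mono)
  with prod_factor_power9[OF n20] have "Res N ^ 9 < real n" by linarith
  also have "real n = (real n powr (1 / 9)) ^ 9"
    using n20 by (simp flip: powr_realpow add: powr_powr)
  finally show ?thesis
    unfolding n_def by (rule power_less_imp_less_base) simp
qed

end
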